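(* For every real $x$ with $0<x<\pi/2$ and every integer $n\geq 2$, \begin{align*} &\left(\frac{2(-1)^{n}}{(2n+1)!}+\frac{2^{2n+2}(2^{2n+2}-1)|B_{2n+2}|}{(2n+2)!}\right)x^{2n-1}\tan x\\ &\quad<2\left(\frac{\sin x}{x}\right)+\frac{\tan x}{x}-\left\{3+\sum_{k=3}^{n}\left(\frac{2(-1)^{k-1}}{(2k-1)!}+\frac{2^{2k}(2^{2k}-1)|B_{2k}|}{(2k)!}\right)x^{2k-2}\right\}\\ &\quad<\left(\frac{2}{\pi}\right)^{2n}x^{2n-1}\tan x. \end{align*}
   Context: $B_n$ ($n\in\mathbb{N}_0=\{0,1,2,\ldots\}$) are the Bernoulli numbers, defined by $\dfrac{t}{e^{t}-1}=\sum_{n=0}^{\infty}B_{n}\dfrac{t^{n}}{n!}$ for $|t|<2\pi$. An empty sum is understood to be zero (so for $n=2$ the sum over $k$ is $0$). *)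

theory Defs
  imports "HOL-Complex_Analysis.Complex_Analysis"
begin

text \<open>
  The Bernoulli numbers, read off from the exponential generating function $t / (e^t - 1)$ as a
  formal power series (so that $B_1 = -1/2$). The analytic form of this generating function,
  valid for $|t| < 2\pi$, is \<open>bernoulli_sums\<close> below.
\<close>

definition bernoulli :: "nat \<Rightarrow> real" where
  "bernoulli n = fact n * fps_nth (fps_X / (fps_exp 1 - 1)) n"

lemma exp_minus_one_ne_0: "z \<noteq> 0 \<Longrightarrow> norm z < 2 * pi \<Longrightarrow> exp z \<noteq> (1 :: complex)"
proof
  assume z: "z \<noteq> 0" "norm z < 2 * pi" "exp z = 1"
  then obtain n :: int where n: "Re z = 0" "Im z = of_int (2 * n) * pi"
    by (auto simp: exp_eq_1)
  have "\<bar>Im z\<bar> < 2 * pi"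
    using abs_Im_le_cmod[of z] z(2) by linarith
  hence "\<bar>of_int n :: real\<bar> < 1"
    by (simp add: n(2) abs_mult)
  hence "n = 0" by linarith
  with n z(1) show False by (simp add: complex_eq_iff)
qed

lemma fps_exp_minus_1:
  "subdegree (fps_exp 1 - 1 :: 'a :: field_char_0 fps) = 1"
  "(fps_exp 1 - 1 :: 'a :: field_char_0 fps) \<noteq> 0"
proof -
  show "subdegree (fps_exp 1 - 1 :: 'a fps) = 1"
    by (intro subdegreeI) auto
  thus "(fps_exp 1 - 1 :: 'a fps) \<noteq> 0" by auto
qed

lemma bernoulli_sums:
  fixes t :: complex
  assumes "t \<noteq> 0" "norm t < 2 * pi"
  shows "(\<lambda>n. of_real (bernoulli n) * t ^ n / fact n) sums (t / (exp t - 1))"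
proof -
  define F :: "real fps" where "F = fps_X / (fps_exp 1 - 1)"
  define G :: "complex fps" where "G = Abs_fps (\<lambda>n. of_real (fps_nth F n))"
  have F: "F * (fps_exp 1 - 1) = fps_X"
    unfolding F_def by (rule dvd_div_mult_self) (simp add: fps_dvd_iff fps_exp_minus_1(2) fps_exp_minus_1(1)[simplified])
  have "G * (fps_exp 1 - 1) = fps_X"
  proof (rule fps_ext)
    fix n
    have "fps_nth (fps_exp 1 - 1 :: complex fps) k
            = of_real (fps_nth (fps_exp 1 - 1 :: real fps) k)" for k
      by simp
    hence "fps_nth (G * (fps_exp 1 - 1)) n = of_real (fps_nth (F * (fps_exp 1 - 1)) n)"
      unfolding fps_mult_nth G_def by (simp only: fps_nth_Abs_fps of_real_sum of_real_mult)
    thus "fps_nth (G * (fps_exp 1 - 1)) n = fps_nth fps_X n"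
      by (simp add: F fps_X_def)
  qed
  hence G: "G = fps_X / (fps_exp 1 - 1)"
    by (metis fps_exp_minus_1(2) nonzero_mult_div_cancel_right)
  define f :: "complex \<Rightarrow> complex" where "f = (\<lambda>z. if z = 0 then 1 else z / (exp z - 1))"
  have f: "f has_fps_expansion G"
    unfolding f_def G
    by (rule has_fps_expansion_divide)
       (auto intro!: fps_expansion_intros simp: fps_exp_minus_1(2) fps_exp_minus_1(1)[simplified])
  have hol: "f holomorphic_on eball 0 (2 * pi)"
    unfolding eball_ereal
  proof (rule no_isolated_singularity'[where K = "{0}"])
    have "isCont f 0"
      using f by (rule has_fps_expansion_imp_continuous)
    thus "(f \<longlongrightarrow> f z) (at z within ball 0 (2 * pi))" if "z \<in> {0}" for z
      using that unfolding isCont_def by (auto intro: filterlim_at_withinI tendsto_within_subset)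
    have "(\<lambda>z. z / (exp z - 1)) holomorphic_on ball 0 (2 * pi) - {0}"
      by (intro holomorphic_intros) (auto simp: exp_minus_one_ne_0)
    thus "f holomorphic_on ball 0 (2 * pi) - {0}"
      by (rule holomorphic_transform) (auto simp: f_def)
  qed auto
  have "(\<lambda>n. fps_nth G n * t ^ n) sums f t"
    by (rule has_fps_expansion_imp_sums_complex[OF f hol]) (simp add: assms(2))
  thus ?thesis
    using assms(1) by (simp add: f_def G_def bernoulli_def F_def)
qed

end

theory Submission
  imports Defs
begin

text \<open>
  Write $\tan x = \sum_{k \ge 1} T_k x^{2k-1}$ and let $c_k = 2(-1)^{k-1}/(2k-1)! + T_k$ be the
  coefficient of $x^{2k-2}$ in $2 \sin x / x + \tan x / x$; here $c_1 = 3$ and $c_2 = 0$. The middle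
  term is the tail $\sum_{j \ge 1} c_{n+j} x^{2(n+j)-2}$, and both estimates hold coefficientwise:
  with $q = 4/\pi^2$ one has $c_{n+1} T_j \le c_{n+j} < q^n T_j$ for all $j \ge 1$.

  The Bernoulli generating function at $t = 2 i x$ identifies $T_k$ up to sign as the $k$-th
  coefficient in the theorem. The partial fractions of the tangent, i.e.\ the logarithmic derivative
  of the reflection formula for $\Gamma$ at $1/2 + x/\pi$, give $T_k = 2 q^k \lambda(2k)$ where
  $\lambda(s) = \sum_{m \ge 0} (2m+1)^{-s}$. As $\lambda(2k)$ decreases to $1$ and the
  contribution of the sine is tiny relative to $q^k$, the coefficient inequalities reduce to
  numerical bounds for $\pi$.
\<close>

subsection \<open>Power series and partial fractions\<close>

text \<open>Once the coefficients below n agree, dividing the difference of the series by x^n leaves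
  a series with sum 0 for x \<noteq> 0, whose limit at 0 is a n - b n. The origin is left out
  because the Bernoulli expansion of x tan x is stated for nonzero x.\<close>

lemma powser_coeffs_unique:
  fixes a b :: "nat \<Rightarrow> 'a :: {real_normed_field, banach}"
  assumes s: "0 < s"
    and a: "\<And>x. x \<noteq> 0 \<Longrightarrow> norm x < s \<Longrightarrow> (\<lambda>n. a n * x ^ n) sums f x"
    and b: "\<And>x. x \<noteq> 0 \<Longrightarrow> norm x < s \<Longrightarrow> (\<lambda>n. b n * x ^ n) sums f x"
  shows "a n = b n"
proof (induction n rule: less_induct)
  case (less n)
  have "(\<lambda>k. (a (k + n) - b (k + n)) * x ^ k) sums 0" if x: "x \<noteq> 0" "norm x < s" for x
  proof -
    have "(\<lambda>k. (a k - b k) * x ^ k) sums 0"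
      using sums_diff[OF a[OF x] b[OF x]] by (simp add: algebra_simps)
    moreover have "(\<Sum>k<n. (a k - b k) * x ^ k) = 0"
      using less by (intro sum.neutral) auto
    ultimately have "(\<lambda>k. (a (k + n) - b (k + n)) * x ^ (k + n)) sums 0"
      by (subst sums_iff_shift) simp
    from sums_divide[OF this, of "x ^ n"] show ?thesis
      using x by (simp add: power_add)
  qed
  from powser_limit_0_strong[of s "\<lambda>k. a (k + n) - b (k + n)" "\<lambda>_. 0", OF s this]
  have "((\<lambda>_::'a. 0) \<longlongrightarrow> a n - b n) (at 0)" by simp
  then have "a n - b n = 0"
    using LIM_unique tendsto_const by metis
  then show ?case by simp
qed

text \<open>Tonelli for series: nonnegativity makes the family summable over all pairs, so rows and
  columns give the same total.\<close>

lemma sums_swap_nonneg: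
  fixes f :: "nat \<Rightarrow> nat \<Rightarrow> real"
  assumes nonneg: "\<And>k j. f k j \<ge> 0"
    and rows: "\<And>k. (\<lambda>j. f k j) sums g k"
    and g: "g sums S"
    and columns: "\<And>j. (\<lambda>k. f k j) sums h j"
  shows "h sums S"
proof -
  have g_nonneg: "g k \<ge> 0" for k
    using rows nonneg by (metis sums_le sums_zero)
  have rows': "((\<lambda>j. f k j) has_sum g k) UNIV" for k
    using rows nonneg by (intro sums_nonneg_imp_has_sum) auto
  have columns': "((\<lambda>k. f k j) has_sum h j) UNIV" for j
    using columns nonneg by (intro sums_nonneg_imp_has_sum) auto
  have g': "(g has_sum S) UNIV"
    using g g_nonneg by (intro sums_nonneg_imp_has_sum) auto
  have "((\<lambda>(k, j). f k j) has_sum S) (UNIV \<times> UNIV)"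
  proof (rule has_sum_SigmaI[where g = g])
    show "(\<lambda>(k, j). f k j) summable_on UNIV \<times> UNIV"
      using rows' g' nonneg by (intro summable_on_SigmaI[where g = g]) (auto simp: summable_on_def)
  qed (use rows' g' in auto)
  then have "((\<lambda>(j, k). f k j) has_sum S) (UNIV \<times> UNIV)"
    by (subst (asm) has_sum_swap) (simp add: case_prod_unfold)
  then have "(h has_sum S) UNIV"
    by (rule has_sum_SigmaD) (use columns' in auto)
  then show ?thesis by (rule has_sum_imp_sums)
qed

section \<open>The digamma function and the poles of the tangent\<close>

text \<open>Digamma z plus Euler's constant is the sum of 1/(k+1) - 1/(z+k). Subtracting the cases z
  = 1/2 + u and z = 1/2 - u cancels the constant and the terms 1/(k+1).\<close>

lemma Digamma_half_diff:
  assumes "\<bar>u\<bar> < (1/2 :: real)"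
  shows "(\<lambda>k. 2 * u / ((real k + 1/2)\<^sup>2 - u\<^sup>2)) sums (Digamma (1/2 + u) - Digamma (1/2 - u))"
proof -
  have *: "(\<lambda>k. inverse (of_nat (Suc k)) - inverse (z + of_nat k)) sums (Digamma z + euler_mascheroni)"
    if "z > 0" for z :: real
    using summable_Digamma[of z] that by (simp add: Digamma_def summable_sums)
  have eq: "inverse (1/2 - u + real k) - inverse (1/2 + u + real k)
      = 2 * u / ((real k + 1/2)\<^sup>2 - u\<^sup>2)" for k
  proof -
    have "1/2 - u + real k > 0" "1/2 + u + real k > 0" using assms by linarith+
    moreover from this have "(real k + 1/2)\<^sup>2 - u\<^sup>2 = (1/2 - u + real k) * (1/2 + u + real k)"
      by (simp add: power2_eq_square algebra_simps)
    ultimately show ?thesis by (simp add: field_simps)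
  qed
  have "1/2 + u > 0" "1/2 - u > 0" using assms by linarith+
  from sums_diff[OF *[OF this(1)] *[OF this(2)]] show ?thesis
    by (simp add: eq)
qed

text \<open>Reflection at z = 1/2 + u, where 1 - z = 1/2 - u, carried out over the complex numbers
  and read back in the reals.\<close>

lemma rGamma_half_reflection:
  "rGamma (1/2 + u) * rGamma (1/2 - u) = cos (pi * u) / (pi :: real)"
proof -
  have "complex_of_real (rGamma (1/2 + u) * rGamma (1/2 - u)) =
      rGamma (of_real (1/2 + u)) * rGamma (1 - of_real (1/2 + u))"
    by (simp add: rGamma_complex_of_real [symmetric])
  also have "\<dots> = complex_of_real (sin (pi * (1/2 + u)) / pi)"
    by (subst rGamma_reflection_complex) (simp only: of_real_mult of_real_divide sin_of_real [symmetric])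
  also have "sin (pi * (1/2 + u)) = cos (pi * u)"
    by (simp add: distrib_left sin_add)
  finally show ?thesis by (simp only: of_real_eq_iff)
qed

text \<open>The reflection product is differentiated in two ways: factor by factor, with rGamma' = -
  rGamma * Digamma, and as cos (pi u) / pi. Then the positive factor cos (pi u) is divided
  out.\<close>

lemma Digamma_half_diff_eq_tan:
  assumes "\<bar>u\<bar> < (1/2 :: real)"
  shows "Digamma (1/2 + u) - Digamma (1/2 - u) = pi * tan (pi * u)"
proof -
  have pos: "1/2 + u \<notin> \<int>\<^sub>\<le>\<^sub>0" "1/2 - u \<notin> \<int>\<^sub>\<le>\<^sub>0"
    using assms by (auto elim!: nonpos_Ints_cases')
  have "((\<lambda>u. rGamma (1/2 + u) * rGamma (1/2 - u)) has_field_derivative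
      - (rGamma (1/2 + u) * rGamma (1/2 - u)) * (Digamma (1/2 + u) - Digamma (1/2 - u))) (at u)"
    by (rule derivative_eq_intros refl pos | simp add: algebra_simps)+
  moreover have "((\<lambda>u. rGamma (1/2 + u) * rGamma (1/2 - u)) has_field_derivative
      - sin (pi * u)) (at u)"
    unfolding rGamma_half_reflection by (auto intro!: derivative_eq_intros)
  ultimately have "cos (pi * u) / pi * (Digamma (1/2 + u) - Digamma (1/2 - u)) = sin (pi * u)"
    unfolding rGamma_half_reflection using DERIV_unique by fastforce
  moreover have "cos (pi * u) > 0"
  proof -
    have "\<bar>pi * u\<bar> < pi / 2"
      using mult_strict_left_mono[OF assms pi_gt_zero] by (simp add: abs_mult)
    then show ?thesis by (intro cos_gt_zero_pi) linarith+
  qed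
  ultimately show ?thesis by (simp add: tan_def field_simps)
qed

text \<open>Here u = x / pi. The number \<open>r k\<close> is the squared ratio of x to the pole (k
  + 1/2) pi, and r / (1 - r) is a geometric series in r.\<close>

lemma tan_partial_fractions:
  fixes x :: real
  assumes "\<bar>x\<bar> < pi / 2"
  defines "r \<equiv> \<lambda>k. (2 * x / ((2 * real k + 1) * pi))\<^sup>2"
  shows "(\<lambda>k. 2 * (r k / (1 - r k))) sums (x * tan x)"
proof -
  have "\<bar>x / pi\<bar> < 1/2" using assms by (simp add: field_simps)
  note u = this
  have "(x / pi) * (2 * (x / pi) / ((real k + 1/2)\<^sup>2 - (x / pi)\<^sup>2)) = 2 * (r k / (1 - r k))" for k
  proof -
    have "(real k + 1/2)\<^sup>2 = ((2 * real k + 1) / 2)\<^sup>2" by (simp add: field_simps)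
    moreover have "r k = (x / pi)\<^sup>2 / ((2 * real k + 1) / 2)\<^sup>2"
      unfolding r_def by (simp only: power_divide [symmetric]) (simp add: mult_ac)
    moreover have "A / C / (1 - A / C) = A / (C - A)" if "C \<noteq> 0" for A C :: real
    proof -
      have "1 - A / C = (C - A) / C" using that by (simp add: diff_divide_distrib)
      then show ?thesis using that by simp
    qed
    from this[of "((2 * real k + 1) / 2)\<^sup>2" "(x / pi)\<^sup>2"]
    have "(x / pi)\<^sup>2 / ((2 * real k + 1) / 2)\<^sup>2 / (1 - (x / pi)\<^sup>2 / ((2 * real k + 1) / 2)\<^sup>2)
        = (x / pi)\<^sup>2 / (((2 * real k + 1) / 2)\<^sup>2 - (x / pi)\<^sup>2)"
      by (simp del: power_divide)
    ultimately show ?thesis by (simp only:) (simp add: power2_eq_square mult_ac)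
  qed
  with sums_mult[OF Digamma_half_diff[OF u], of "x / pi"] show ?thesis
    unfolding Digamma_half_diff_eq_tan[OF u] by simp
qed

text \<open>\<open>odd_zeta j\<close> is $\lambda(2j)$; at $j = 0$ the series diverges and the value is junk.\<close>

definition odd_zeta :: "nat \<Rightarrow> real" where
  "odd_zeta j = (\<Sum>k. (1 / (2 * real k + 1)\<^sup>2) ^ j)"

lemma odd_zeta_sums:
  assumes "j > 0"
  shows "(\<lambda>k. (1 / (2 * real k + 1)\<^sup>2) ^ j) sums odd_zeta j"
proof -
  have "summable (\<lambda>k. inverse (real (Suc k) ^ 2))"
    using inverse_power_summable[of 2, where ?'a = real] by (subst summable_Suc_iff) simp
  moreover have "norm ((1 / (2 * real k + 1)\<^sup>2) ^ j) \<le> inverse (real (Suc k) ^ 2)" for k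
  proof -
    have "(1 / (2 * real k + 1)\<^sup>2) ^ j \<le> (1 / (2 * real k + 1)\<^sup>2) ^ 1"
      using assms by (intro power_decreasing) (auto simp: divide_simps)
    also have "\<dots> \<le> inverse (real (Suc k) ^ 2)"
      by (simp add: inverse_eq_divide divide_simps)
    finally show ?thesis by simp
  qed
  ultimately have "summable (\<lambda>k. (1 / (2 * real k + 1)\<^sup>2) ^ j)"
    by (rule summable_comparison_test'[where N = 0])
  then show ?thesis unfolding odd_zeta_def by (rule summable_sums)
qed

text \<open>Each partial fraction is expanded as a geometric series, which converges since |x| <
  pi/2 forces \<open>r k\<close> < 1. The terms are nonnegative, so the order of summation may be
  exchanged; the sum over k is then an \<open>odd_zeta\<close> value.\<close>

lemma x_tan_sums_odd_zeta:
  fixes x :: real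
  assumes "\<bar>x\<bar> < pi / 2"
  shows "(\<lambda>j. 2 * (4 / pi\<^sup>2) ^ Suc j * odd_zeta (Suc j) * x ^ (2 * Suc j)) sums (x * tan x)"
proof -
  define r where "r k = (2 * x / ((2 * real k + 1) * pi))\<^sup>2" for k
  have r: "0 \<le> r k" "r k < 1" for k
  proof -
    have "\<bar>2 * x\<bar> < 1 * pi" using assms by (simp add: field_simps)
    also have "\<dots> \<le> (2 * real k + 1) * pi" by (intro mult_right_mono) auto
    finally have "\<bar>2 * x / ((2 * real k + 1) * pi)\<bar> < 1" by (simp add: abs_mult)
    then show "r k < 1" unfolding r_def by (simp add: abs_square_less_1)
  qed (simp add: r_def)
  show ?thesis
  proof (rule sums_swap_nonneg[where f = "\<lambda>k j. 2 * r k ^ Suc j"])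
    show "(\<lambda>k. 2 * (r k / (1 - r k))) sums (x * tan x)"
      unfolding r_def by (rule tan_partial_fractions[OF assms])
    show "(\<lambda>j. 2 * r k ^ Suc j) sums (2 * (r k / (1 - r k)))" for k
      using sums_mult[OF geometric_sums[of "r k"], of "2 * r k"] r[of k]
      by (simp add: mult.assoc)
    show "2 * r k ^ Suc j \<ge> 0" for k j using r[of k] by simp
    show "(\<lambda>k. 2 * r k ^ Suc j) sums (2 * (4 / pi\<^sup>2) ^ Suc j * odd_zeta (Suc j) * x ^ (2 * Suc j))" for j
    proof -
      have "2 * r k ^ Suc j = 2 * (4 / pi\<^sup>2) ^ Suc j * x ^ (2 * Suc j) * (1 / (2 * real k + 1)\<^sup>2) ^ Suc j" for k
      proof -
        have "r k = 4 / pi\<^sup>2 * x\<^sup>2 * (1 / (2 * real k + 1)\<^sup>2)"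
          by (simp add: r_def power_divide power_mult_distrib)
        then show ?thesis by (simp only: power_mult_distrib power_mult mult.assoc)
      qed
      with sums_mult[OF odd_zeta_sums[of "Suc j"], of "2 * (4 / pi\<^sup>2) ^ Suc j * x ^ (2 * Suc j)"]
      show ?thesis by (simp add: mult_ac)
    qed
  qed
qed

subsection \<open>Bernoulli numbers and the tangent coefficients\<close>

text \<open>Put t = 2ix in the generating function. As e^t - 1 = 2i sin x e^(ix), the quotient is (x
  / sin x) e^(-ix), with real part x cot x.\<close>

lemma x_cot_sums_bernoulli:
  fixes x :: real
  assumes "x \<noteq> 0" "\<bar>x\<bar> < pi"
  shows "(\<lambda>n. bernoulli n * Re (\<i> ^ n) / fact n * (2 * x) ^ n) sums (x * cot x)"
proof -
  define t where "t = \<i> * of_real (2 * x)"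
  have sin: "sin x \<noteq> 0"
    using assms sin_gt_zero[of x] sin_gt_zero[of "-x"] by (cases "x > 0") auto
  have "exp t = cis x * cis x"
    by (simp add: t_def cis_conv_exp exp_add [symmetric] algebra_simps)
  then have "exp t - 1 = cis x * (cis x - cis (- x))"
    by (simp add: right_diff_distrib cis_mult)
  also have "cis x - cis (- x) = 2 * \<i> * sin x"
    by (simp add: complex_eq_iff)
  finally have "t / (exp t - 1) = of_real (x / sin x) * (1 / cis x)"
    using sin by (simp add: t_def divide_simps)
  also have "1 / cis x = cis (- x)"
    by (simp add: cis_inverse divide_inverse)
  finally have "Re (t / (exp t - 1)) = x * cot x"
    by (simp add: cot_def)
  moreover have "(\<lambda>n. of_real (bernoulli n) * t ^ n / fact n) sums (t / (exp t - 1))"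
    using assms by (intro bernoulli_sums) (auto simp: t_def norm_mult)
  from sums_Re[OF this]
  have "(\<lambda>n. Re (of_real (bernoulli n) * t ^ n / fact n)) sums Re (t / (exp t - 1))" .
  moreover have "Re (of_real (bernoulli n) * t ^ n / fact n) = bernoulli n * Re (\<i> ^ n) / fact n * (2 * x) ^ n" for n
  proof -
    have "of_real (bernoulli n) * t ^ n / fact n
        = \<i> ^ n * complex_of_real (bernoulli n / fact n * (2 * x) ^ n)"
      by (simp add: t_def power_mult_distrib)
    then show ?thesis
      by (simp only: times_complex.sel Re_complex_of_real Im_complex_of_real) simp
  qed
  ultimately show ?thesis by simp
qed

text \<open>This uses tan x = cot x - 2 cot (2x): replacing x by 2x scales the n-th cotangent
  coefficient by 2^n, whence the factor 1 - 2^n.\<close>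

lemma x_tan_sums_bernoulli:
  fixes x :: real
  assumes "x \<noteq> 0" "\<bar>x\<bar> < pi / 2"
  shows "(\<lambda>n. bernoulli n * Re (\<i> ^ n) * 2 ^ n * (1 - 2 ^ n) / fact n * x ^ n) sums (x * tan x)"
proof -
  have sin: "sin x \<noteq> 0"
    using assms sin_gt_zero[of x] sin_gt_zero[of "-x"] by (cases "x > 0") auto
  have cos: "cos x \<noteq> 0"
    using assms(2) cos_gt_zero_pi[of x] by linarith
  have "\<bar>x\<bar> < pi" "2 * x \<noteq> 0" "\<bar>2 * x\<bar> < pi" using assms by auto
  from sums_diff[OF x_cot_sums_bernoulli[OF assms(1) this(1)] x_cot_sums_bernoulli[OF this(2,3)]]
  have "(\<lambda>n. bernoulli n * Re (\<i> ^ n) / fact n * (2 * x) ^ n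
      - bernoulli n * Re (\<i> ^ n) / fact n * (2 * (2 * x)) ^ n) sums (x * cot x - 2 * x * cot (2 * x))" .
  moreover have "bernoulli n * Re (\<i> ^ n) / fact n * (2 * x) ^ n
      - bernoulli n * Re (\<i> ^ n) / fact n * (2 * (2 * x)) ^ n
      = bernoulli n * Re (\<i> ^ n) * 2 ^ n * (1 - 2 ^ n) / fact n * x ^ n" for n
  proof -
    have "(4::real) ^ n = 2 ^ n * 2 ^ n" by (simp flip: power_mult_distrib)
    then show ?thesis by (simp add: power_mult_distrib field_simps)
  qed
  moreover have "x * cot x - 2 * x * cot (2 * x) = x * tan x"
  proof -
    have cot_double: "cot (2 * x) = ((cos x)\<^sup>2 - (sin x)\<^sup>2) / (2 * sin x * cos x)"
      by (simp add: cot_def sin_double cos_double)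
    show ?thesis
      using sin cos unfolding cot_double by (simp add: cot_def tan_def field_simps power2_eq_square)
  qed
  ultimately show ?thesis by simp
qed

text \<open>This is T_k, kept in the shape in which it occurs in the theorem.\<close>

definition tan_coeff :: "nat \<Rightarrow> real" where
  "tan_coeff k = 2 ^ (2 * k) * (2 ^ (2 * k) - 1) * \<bar>bernoulli (2 * k)\<bar> / fact (2 * k)"

lemma odd_zeta_ge_1:
  assumes "j > 0"
  shows "odd_zeta j \<ge> 1"
proof -
  have "(\<Sum>k<1. (1 / (2 * real k + 1)\<^sup>2) ^ j) \<le> odd_zeta j"
    unfolding odd_zeta_def
    using odd_zeta_sums[OF assms] by (intro sum_le_suminf) (auto simp: sums_iff)
  then show ?thesis by simp
qed

text \<open>Both expansions of x tan x have the same coefficient at x^(2k). Passing to absolute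
  values avoids determining the sign of the Bernoulli number.\<close>

lemma tan_coeff_eq_odd_zeta:
  assumes "k > 0"
  shows "tan_coeff k = 2 * (4 / pi\<^sup>2) ^ k * odd_zeta k"
proof -
  define a :: "nat \<Rightarrow> real"
    where "a n = bernoulli n * Re (\<i> ^ n) * 2 ^ n * (1 - 2 ^ n) / fact n" for n
  \<comment> \<open>The even series is padded with zeros so that it runs over all exponents. The
    condition n > 0 sets the constant term to 0 and keeps out the junk value
    \<open>odd_zeta 0\<close>.\<close>
  define b :: "nat \<Rightarrow> real"
    where "b n = (if even n \<and> n > 0 then 2 * (4 / pi\<^sup>2) ^ (n div 2) * odd_zeta (n div 2) else 0)" for n
  have "a (2 * k) = b (2 * k)"
  proof (rule powser_coeffs_unique)
    show "(\<lambda>n. a n * x ^ n) sums (x * tan x)" if "x \<noteq> 0" "norm x < pi / 2" for x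
      unfolding a_def using that by (intro x_tan_sums_bernoulli) auto
    show "(\<lambda>n. b n * x ^ n) sums (x * tan x)" if "x \<noteq> 0" "norm x < pi / 2" for x
    proof -
      have "(\<lambda>j. b (2 * Suc j) * x ^ (2 * Suc j)) sums (x * tan x)"
        using x_tan_sums_odd_zeta[of x] that by (simp add: b_def)
      moreover have "strict_mono (\<lambda>j. 2 * Suc j)" by (auto simp: strict_mono_def)
      moreover have "b n = 0" if "n \<notin> range (\<lambda>j. 2 * Suc j)" for n
      proof (rule ccontr)
        assume "b n \<noteq> 0"
        then have "even n" "n > 0" by (auto simp: b_def split: if_splits)
        then obtain m where "n = 2 * m" "m > 0" by (auto elim!: evenE)
        then have "n = 2 * Suc (m - 1)" by simp
        with that show False by blast
      qed
      ultimately show ?thesis by (subst (asm) sums_mono_reindex) auto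
    qed
  qed auto
  then have "\<bar>a (2 * k)\<bar> = \<bar>b (2 * k)\<bar>" by simp
  moreover have "\<bar>a (2 * k)\<bar> = tan_coeff k"
  proof -
    have "\<i> ^ (2 * k) = of_real ((-1) ^ k)" by (simp add: power_mult)
    then have "Re (\<i> ^ (2 * k)) = (-1) ^ k" by (simp only: Re_complex_of_real)
    moreover have "(1::real) \<le> 2 ^ (2 * k)" by simp
    ultimately show ?thesis unfolding a_def tan_coeff_def by (simp add: abs_mult)
  qed
  moreover have "\<bar>b (2 * k)\<bar> = 2 * (4 / pi\<^sup>2) ^ k * odd_zeta k"
    using assms odd_zeta_ge_1[of k] by (simp add: b_def abs_mult)
  ultimately show ?thesis by simp
qed

text \<open>Compare coefficients of t^(n+1) in F(t) (e^t - 1) = t. The sum stops at n because e^t -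
  1 has no constant term.\<close>

lemma bernoulli_recurrence:
  "(\<Sum>i\<le>n. bernoulli i / (fact i * fact (Suc n - i))) = (if n = 0 then 1 else 0)"
proof -
  define F :: "real fps" where "F = fps_X / (fps_exp 1 - 1)"
  have "F * (fps_exp 1 - 1) = fps_X"
    unfolding F_def by (rule dvd_div_mult_self)
      (simp add: fps_dvd_iff fps_exp_minus_1(2) fps_exp_minus_1(1)[simplified])
  then have "fps_nth (F * (fps_exp 1 - 1)) (Suc n) = (if n = 0 then 1 else 0)"
    by simp
  moreover have "fps_nth (F * (fps_exp 1 - 1)) (Suc n)
      = (\<Sum>i\<le>n. bernoulli i / (fact i * fact (Suc n - i)))"
    unfolding fps_mult_nth atLeast0AtMost
    by (simp add: bernoulli_def F_def Suc_diff_le divide_simps)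
  ultimately show ?thesis by simp
qed

text \<open>These values give c_1 = 3 and c_2 = 0. They also encode \<open>odd_zeta 1\<close> =
  pi^2/8 and \<open>odd_zeta 2\<close> = pi^4/96, from which the numerical bounds are drawn.\<close>

lemma tan_coeff_1: "tan_coeff 1 = 1" and tan_coeff_2: "tan_coeff 2 = 1 / 3"
proof -
  note B = bernoulli_recurrence[of 0] bernoulli_recurrence[of 1] bernoulli_recurrence[of 2]
    bernoulli_recurrence[of 3] bernoulli_recurrence[of 4]
  have "bernoulli 0 = 1" using B(1) by simp
  moreover from this have "bernoulli 1 = - 1 / 2" using B(2) by simp
  moreover from calculation have B2: "bernoulli 2 = 1 / 6"
    using B(3) by (simp add: numeral_eq_Suc field_simps)
  moreover from calculation have "bernoulli 3 = 0"
    using B(4) by (simp add: numeral_eq_Suc field_simps)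
  ultimately have B4: "bernoulli 4 = - 1 / 30"
    using B(5) by (simp add: numeral_eq_Suc field_simps)
  show "tan_coeff 1 = 1" "tan_coeff 2 = 1 / 3"
    by (simp_all add: tan_coeff_def B2 B4 fact_numeral)
qed

subsection \<open>Coefficient inequalities\<close>

lemma odd_zeta_antimono:
  assumes "0 < j" "j \<le> m"
  shows "odd_zeta m \<le> odd_zeta j"
proof (rule sums_le[OF _ odd_zeta_sums odd_zeta_sums])
  show "(1 / (2 * real k + 1)\<^sup>2) ^ m \<le> (1 / (2 * real k + 1)\<^sup>2) ^ j" for k
    using assms by (intro power_decreasing) (auto simp: divide_simps)
qed (use assms in auto)

text \<open>Only the terms k = 0 and k = 1 of the difference are kept. The first is 0, the second is
  9^(-j) (1 - 9^(-n)), and n \<ge> 2 gives the factor 80/81.\<close>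

lemma odd_zeta_gap:
  assumes "0 < j" "2 \<le> n"
  shows "80 / 81 * (1 / 9) ^ j \<le> odd_zeta j - odd_zeta (n + j)"
proof -
  define d where "d k = (1 / (2 * real k + 1)\<^sup>2) ^ j - (1 / (2 * real k + 1)\<^sup>2) ^ (n + j)" for k
  have d: "d sums (odd_zeta j - odd_zeta (n + j))"
    unfolding d_def using assms by (intro sums_diff odd_zeta_sums) auto
  have "d k \<ge> 0" for k
    unfolding d_def diff_ge_0_iff_ge by (intro power_decreasing) (auto simp: divide_simps)
  with d have "(\<Sum>k<2. d k) \<le> odd_zeta j - odd_zeta (n + j)"
    using sum_le_suminf[of d "{..<2}"] by (simp add: sums_iff)
  then have "(1 / 9) ^ j - (1 / 9) ^ (n + j) \<le> odd_zeta j - odd_zeta (n + j)"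
    by (simp add: d_def numeral_2_eq_2)
  moreover have "(1 / 9 :: real) ^ n \<le> (1 / 9) ^ 2"
    using assms by (intro power_decreasing) auto
  then have "(1 / 9 :: real) ^ n * (1 / 9) ^ j \<le> (1 / 81) * (1 / 9) ^ j"
    by (intro mult_right_mono) (auto simp: power2_eq_square)
  ultimately show ?thesis unfolding power_add by linarith
qed

section \<open>Numerical bounds\<close>

lemma four_over_pi_sq_bounds: "405 / 1000 < 4 / pi\<^sup>2" "4 / pi\<^sup>2 < 4053 / 10000"
proof -
  have "pi\<^sup>2 \<le> (31416 / 10000)\<^sup>2" "(314159 / 100000)\<^sup>2 \<le> pi\<^sup>2"
    using pi_approx by (auto intro!: power_mono)
  then have "pi\<^sup>2 < 4 / (405 / 1000)" "4 / (4053 / 10000) < pi\<^sup>2"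
    by (simp_all add: power2_eq_square)
  then show "405 / 1000 < 4 / pi\<^sup>2" "4 / pi\<^sup>2 < 4053 / 10000"
    by (simp_all add: field_simps)
qed

lemma odd_zeta_1: "odd_zeta 1 > 1233 / 1000"
proof -
  define q where "q = 4 / pi\<^sup>2"
  have "q * (2 * odd_zeta 1) = 1"
    using tan_coeff_eq_odd_zeta[of 1] unfolding tan_coeff_1 q_def [symmetric] by simp
  moreover have "q * (2 * odd_zeta 1) \<le> 4053 / 10000 * (2 * odd_zeta 1)"
    using four_over_pi_sq_bounds odd_zeta_ge_1[of 1] unfolding q_def by (intro mult_right_mono) auto
  ultimately show ?thesis by linarith
qed

lemma odd_zeta_2: "odd_zeta 2 < 10162 / 10000"
proof -
  define q where "q = 4 / pi\<^sup>2"
  have "q\<^sup>2 * (6 * odd_zeta 2) = 1"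
    using tan_coeff_eq_odd_zeta[of 2] unfolding tan_coeff_2 q_def [symmetric] by simp
  moreover have "(405 / 1000)\<^sup>2 * (6 * odd_zeta 2) \<le> q\<^sup>2 * (6 * odd_zeta 2)"
    using four_over_pi_sq_bounds odd_zeta_ge_1[of 2] unfolding q_def
    by (intro mult_right_mono power_mono) auto
  ultimately have "(405 / 1000)\<^sup>2 * (6 * odd_zeta 2) \<le> 1" by linarith
  then show ?thesis by (simp add: power2_eq_square)
qed

text \<open>
  The size of $q^m$ relative to the coefficient $1/(2m-1)!$ of the sine.
\<close>

definition fact_weight :: "nat \<Rightarrow> real" where
  "fact_weight m = fact (2 * m - 1) * (4 / pi\<^sup>2) ^ m"

text \<open>The ratio is (2m+1)(2m)q with q = 4/pi^2, at least 42 * 0.405 for m \<ge> 3. The factor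
  9 suffices to keep pace with the 9^(-j) in \<open>odd_zeta_gap\<close>.\<close>

lemma fact_weight_Suc:
  assumes "m \<ge> 3"
  shows "9 * fact_weight m \<le> fact_weight (Suc m)"
proof -
  obtain p where m: "m = Suc p" using assms by (cases m) auto
  have "fact_weight (Suc m) = (2 * real m + 1) * (2 * real m) * (4 / pi\<^sup>2) * fact_weight m"
  proof -
    have "2 * Suc m - 1 = Suc (Suc (2 * m - 1))" "real (Suc (2 * m - 1)) = 2 * real m"
      by (simp_all add: m)
    then show ?thesis
      by (simp add: fact_weight_def m del: of_nat_Suc)
  qed
  moreover have "9 \<le> (2 * real m + 1) * (2 * real m) * (4 / pi\<^sup>2)"
  proof -
    have "(7 * 6) * (405 / 1000) \<le> (2 * real m + 1) * (2 * real m) * (4 / pi\<^sup>2)"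
      using assms four_over_pi_sq_bounds(1) by (intro mult_mono) auto
    then show ?thesis by simp
  qed
  moreover have "fact_weight m \<ge> 0" by (simp add: fact_weight_def)
  ultimately show ?thesis by (simp only: mult_right_mono)
qed

lemma fact_weight_mono:
  assumes "3 \<le> k" "k \<le> m"
  shows "fact_weight k \<le> fact_weight m"
  using assms(2,1)
proof (induction rule: dec_induct)
  case (step m)
  have "fact_weight m \<ge> 0" by (simp add: fact_weight_def)
  then show ?case using step fact_weight_Suc[of m] by linarith
qed auto

lemma fact_weight_3: "fact_weight 3 > 79 / 10" and fact_weight_4: "fact_weight 4 > 135"
proof -
  have "(405 / 1000) ^ 3 \<le> (4 / pi\<^sup>2) ^ 3" "(405 / 1000) ^ 4 \<le> (4 / pi\<^sup>2) ^ 4"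
    using four_over_pi_sq_bounds(1) by (intro power_mono; simp)+
  then show "fact_weight 3 > 79 / 10" "fact_weight 4 > 135"
    by (simp_all add: fact_weight_def fact_numeral power_divide)
qed

text \<open>The factor 81/80 is the inverse of the one in \<open>odd_zeta_gap\<close>. The bound
  fails at j = 1, where \<open>fact_weight 3\<close> is about 7.99.\<close>

lemma fact_weight_gt_power_9:
  assumes "j \<ge> 2"
  shows "81 / 80 * 9 ^ j < fact_weight (j + 2)"
  using assms
proof (induction rule: dec_induct)
  case base
  then show ?case using fact_weight_4 by simp
next
  case (step j)
  then show ?case using fact_weight_Suc[of "j + 2"] by simp
qed

section \<open>The two coefficientwise estimates\<close>

definition sin_tan_coeff :: "nat \<Rightarrow> real" where
  "sin_tan_coeff k = 2 * (-1) ^ (k - 1) / fact (2 * k - 1) + tan_coeff k"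

text \<open>The sine contributes 2/(2m-1)! in absolute value, which is 2 q^m /
  \<open>fact_weight m\<close>; its sign is ignored.\<close>

lemma sin_tan_coeff_bounds:
  assumes "m > 0"
  shows "2 * (4 / pi\<^sup>2) ^ m * (odd_zeta m - 1 / fact_weight m) \<le> sin_tan_coeff m"
    and "sin_tan_coeff m \<le> 2 * (4 / pi\<^sup>2) ^ m * (odd_zeta m + 1 / fact_weight m)"
proof -
  have "2 * (4 / pi\<^sup>2) ^ m * (1 / fact_weight m) = 2 / fact (2 * m - 1)"
    by (simp add: fact_weight_def)
  moreover have "\<bar>2 * (-1) ^ (m - 1) / fact (2 * m - 1) :: real\<bar> = 2 / fact (2 * m - 1)"
    by (simp add: abs_mult power_abs)
  ultimately show "2 * (4 / pi\<^sup>2) ^ m * (odd_zeta m - 1 / fact_weight m) \<le> sin_tan_coeff m"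
    and "sin_tan_coeff m \<le> 2 * (4 / pi\<^sup>2) ^ m * (odd_zeta m + 1 / fact_weight m)"
    unfolding sin_tan_coeff_def tan_coeff_eq_odd_zeta[OF assms] distrib_left right_diff_distrib
    by linarith+
qed

lemma sin_tan_coeff_add_less:
  assumes "n \<ge> 2" "j > 0"
  shows "sin_tan_coeff (n + j) < (4 / pi\<^sup>2) ^ n * tan_coeff j"
proof -
  have pos: "fact_weight (n + j) > 0" by (simp add: fact_weight_def)
  \<comment> \<open>This is the claim divided by 2 q^(n+j), with the sine bounded by its absolute
    value. For j = 1 the gap is at least 1.233 - 1.0162 > 0.21; for j \<ge> 2 the powers of 9
    cancel.\<close>
  have "1 < fact_weight (n + j) * (odd_zeta j - odd_zeta (n + j))"
  proof (cases "j = 1")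
    case True
    have "odd_zeta (n + 1) \<le> odd_zeta 2" using assms by (intro odd_zeta_antimono) auto
    then have "21 / 100 \<le> odd_zeta j - odd_zeta (n + j)"
      using odd_zeta_1 odd_zeta_2 True by simp
    moreover have "79 / 10 \<le> fact_weight (n + j)"
      using fact_weight_mono[of 3 "n + j"] fact_weight_3 assms by simp
    ultimately have "79 / 10 * (21 / 100) \<le> fact_weight (n + j) * (odd_zeta j - odd_zeta (n + j))"
      by (intro mult_mono) auto
    then show ?thesis by simp
  next
    case False
    have "81 / 80 * 9 ^ j < fact_weight (n + j)"
      using fact_weight_gt_power_9[of j] fact_weight_mono[of "j + 2" "n + j"] assms False by simp
    then have "81 / 80 * 9 ^ j * (80 / 81 * (1 / 9) ^ j) < fact_weight (n + j) * (80 / 81 * (1 / 9) ^ j)"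
      by (rule mult_strict_right_mono) simp
    also have "\<dots> \<le> fact_weight (n + j) * (odd_zeta j - odd_zeta (n + j))"
      using odd_zeta_gap[of j n] assms pos by (intro mult_left_mono) auto
    finally show ?thesis by (simp add: power_divide)
  qed
  then have "odd_zeta (n + j) + 1 / fact_weight (n + j) < odd_zeta j"
    using pos by (simp add: field_simps)
  then have "2 * (4 / pi\<^sup>2) ^ (n + j) * (odd_zeta (n + j) + 1 / fact_weight (n + j))
      < 2 * (4 / pi\<^sup>2) ^ (n + j) * odd_zeta j"
    by (rule mult_strict_left_mono) simp
  also have "\<dots> = (4 / pi\<^sup>2) ^ n * tan_coeff j"
    using assms by (simp add: tan_coeff_eq_odd_zeta power_add)
  finally show ?thesis
    using sin_tan_coeff_bounds(2)[of "n + j"] assms by linarith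
qed

text \<open>After division by 2 q^(n+j) the left side is at most 2 * 1.15 * 1.0162 * q < 0.948, and
  the right side is at least 1 - 1/135 > 0.99.\<close>

lemma sin_tan_coeff_Suc_mult_less:
  assumes "n \<ge> 2" "j \<ge> 2"
  shows "sin_tan_coeff (n + 1) * tan_coeff j < sin_tan_coeff (n + j)"
proof -
  define q where "q = 4 / pi\<^sup>2"
  have q: "0 < q" "q < 4053 / 10000" using four_over_pi_sq_bounds by (auto simp: q_def)
  have zeta: "odd_zeta m < 10162 / 10000" if "m \<ge> 2" for m
    using odd_zeta_antimono[of 2 m] odd_zeta_2 that by simp
  have weight: "1 / fact_weight (n + 1) \<le> 10 / 79" "1 / fact_weight (n + j) \<le> 1 / 135"
    using fact_weight_mono[of 3 "n + 1"] fact_weight_mono[of 4 "n + j"] fact_weight_3 fact_weight_4 assms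
    by (auto simp: field_simps)
  have "sin_tan_coeff (n + 1) \<le> 2 * q ^ (n + 1) * (odd_zeta (n + 1) + 1 / fact_weight (n + 1))"
    unfolding q_def using assms by (intro sin_tan_coeff_bounds) auto
  \<comment> \<open>The constant 1.15 covers 1.0162 + 10/79.\<close>
  also have "\<dots> \<le> 2 * q ^ (n + 1) * (115 / 100)"
    using zeta[of "n + 1"] weight(1) q assms by (intro mult_left_mono) auto
  finally have "sin_tan_coeff (n + 1) * tan_coeff j \<le> 2 * q ^ (n + 1) * (115 / 100) * tan_coeff j"
    by (rule mult_right_mono) (simp add: tan_coeff_def)
  also have "\<dots> \<le> 2 * q ^ (n + 1) * (115 / 100) * (2 * q ^ j * (10162 / 10000))"
    using zeta[of j] q assms by (intro mult_left_mono) (auto simp: tan_coeff_eq_odd_zeta q_def)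
  also have "\<dots> = 2 * q ^ (n + j) * (q * (2 * (115 / 100) * (10162 / 10000)))"
    by (simp add: power_add)
  also have "\<dots> < 2 * q ^ (n + j) * (1 - 1 / 135)"
    using q by (intro mult_strict_left_mono) auto
  also have "\<dots> \<le> 2 * q ^ (n + j) * (odd_zeta (n + j) - 1 / fact_weight (n + j))"
    using odd_zeta_ge_1[of "n + j"] weight(2) q assms by (intro mult_left_mono) auto
  also have "\<dots> \<le> sin_tan_coeff (n + j)"
    unfolding q_def using assms by (intro sin_tan_coeff_bounds) auto
  finally show ?thesis .
qed

section \<open>Expansion of the middle term and conclusion\<close>

lemma sin_sums_odd:
  fixes x :: real
  shows "(\<lambda>k. (-1) ^ k / fact (2 * k + 1) * x ^ (2 * k + 1)) sums sin x"
proof -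
  have "(\<lambda>n. sin_coeff n * x ^ n) sums sin x"
    using sin_converges[of x] by simp
  moreover have "strict_mono (\<lambda>k::nat. 2 * k + 1)" by (auto simp: strict_mono_def)
  moreover have "sin_coeff n = 0" if "n \<notin> range (\<lambda>k. 2 * k + 1)" for n
  proof -
    have "even n" using that by (metis oddE rangeI)
    then show ?thesis by (simp add: sin_coeff_def)
  qed
  ultimately have "(\<lambda>k. sin_coeff (2 * k + 1) * x ^ (2 * k + 1)) sums sin x"
    by (subst sums_mono_reindex) auto
  then show ?thesis by (simp add: sin_coeff_def)
qed

lemma tan_coeff_sums:
  fixes x :: real
  assumes "\<bar>x\<bar> < pi / 2"
  shows "(\<lambda>j. tan_coeff (Suc j) * x ^ (2 * Suc j)) sums (x * tan x)"
  using x_tan_sums_odd_zeta[OF assms] by (simp add: tan_coeff_eq_odd_zeta)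

lemma sin_tan_coeff_sums:
  fixes x :: real
  assumes "x \<noteq> 0" "\<bar>x\<bar> < pi / 2"
  shows "(\<lambda>k. sin_tan_coeff (Suc k) * x ^ (2 * k)) sums (2 * (sin x / x) + tan x / x)"
proof -
  have "(\<lambda>k. 2 / x * ((-1) ^ k / fact (2 * k + 1) * x ^ (2 * k + 1))
        + 1 / x\<^sup>2 * (tan_coeff (Suc k) * x ^ (2 * Suc k))) sums
      (2 / x * sin x + 1 / x\<^sup>2 * (x * tan x))"
    by (intro sums_add sums_mult sin_sums_odd tan_coeff_sums assms)
  moreover have "2 / x * ((-1) ^ k / fact (2 * k + 1) * x ^ (2 * k + 1))
        + 1 / x\<^sup>2 * (tan_coeff (Suc k) * x ^ (2 * Suc k)) = sin_tan_coeff (Suc k) * x ^ (2 * k)" for k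
  proof -
    have "2 / x * (s / f * x ^ (2 * k + 1)) + 1 / x\<^sup>2 * (t * x ^ (2 * Suc k)) = (2 * s / f + t) * x ^ (2 * k)"
      for s f t
      using assms(1) by (simp add: power2_eq_square distrib_right)
    then show ?thesis unfolding sin_tan_coeff_def by simp
  qed
  moreover have "2 / x * sin x + 1 / x\<^sup>2 * (x * tan x) = 2 * (sin x / x) + tan x / x"
    using assms(1) by (simp add: power2_eq_square)
  ultimately show ?thesis by (simp only:)
qed

text \<open>The values c_1 = 3 and c_2 = 0 account for the constant 3 and for the sum starting at k
  = 3.\<close>

lemma sum_sin_tan_coeff_lessThan:
  fixes x :: real
  assumes "n \<ge> 2"
  shows "(\<Sum>k<n. sin_tan_coeff (Suc k) * x ^ (2 * k)) = 3 + (\<Sum>k = 3..n. sin_tan_coeff k * x ^ (2 * k - 2))"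
  using assms
proof (induction rule: dec_induct)
  case base
  have "sin_tan_coeff 1 = 3" "sin_tan_coeff 2 = 0"
    using tan_coeff_1 tan_coeff_2 by (simp_all add: sin_tan_coeff_def fact_numeral)
  then show ?case by (simp add: numeral_2_eq_2)
qed simp

lemma sums_strict_less:
  fixes f g :: "nat \<Rightarrow> real"
  assumes "f sums s" "g sums t" "\<And>n. f n \<le> g n" "f i < g i"
  shows "s < t"
proof -
  have d: "(\<lambda>n. g n - f n) sums (t - s)" using assms by (intro sums_diff)
  have "0 < (\<Sum>n. g n - f n)"
    using d assms by (intro suminf_pos2[where i = i]) (auto simp: sums_iff)
  with d show ?thesis by (simp add: sums_iff)
qed

theorem theorem3p2:
  fixes x :: real and n :: nat
  assumes "0 < x" and "x < pi / 2" and "n \<ge> 2"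
  shows
    "(2 * (-1) ^ n / fact (2 * n + 1)
        + 2 ^ (2 * n + 2) * (2 ^ (2 * n + 2) - 1) * \<bar>bernoulli (2 * n + 2)\<bar> / fact (2 * n + 2))
        * x ^ (2 * n - 1) * tan x
      < 2 * (sin x / x) + tan x / x
        - (3 + (\<Sum>k = 3..n.
            (2 * (-1) ^ (k - 1) / fact (2 * k - 1)
              + 2 ^ (2 * k) * (2 ^ (2 * k) - 1) * \<bar>bernoulli (2 * k)\<bar> / fact (2 * k))
            * x ^ (2 * k - 2)))
     \<and> 2 * (sin x / x) + tan x / x
        - (3 + (\<Sum>k = 3..n.
            (2 * (-1) ^ (k - 1) / fact (2 * k - 1)
              + 2 ^ (2 * k) * (2 ^ (2 * k) - 1) * \<bar>bernoulli (2 * k)\<bar> / fact (2 * k))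
            * x ^ (2 * k - 2)))
      < (2 / pi) ^ (2 * n) * x ^ (2 * n - 1) * tan x"
proof -
  define R where "R = 2 * (sin x / x) + tan x / x - (3 + (\<Sum>k = 3..n. sin_tan_coeff k * x ^ (2 * k - 2)))"
  have x: "x \<noteq> 0" "\<bar>x\<bar> < pi / 2" using assms by auto
  have R: "(\<lambda>j. sin_tan_coeff (n + Suc j) * x ^ (2 * (j + n))) sums R"
    unfolding R_def sum_sin_tan_coeff_lessThan[OF assms(3), symmetric]
    using sums_split_initial_segment[OF sin_tan_coeff_sums[OF x], of n] by (simp add: add_ac)
  \<comment> \<open>Both outer bounds have this form, with a = c_(n+1) and a = q^n. The exponents
    match those of the tail \<open>R\<close>, so the comparison is term by term.\<close>
  have tan: "(\<lambda>j. a * tan_coeff (Suc j) * x ^ (2 * (j + n))) sums (a * x ^ (2 * n - 1) * tan x)" for a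
  proof -
    obtain p where n: "n = Suc p" using assms(3) by (cases n) auto
    from sums_mult[OF tan_coeff_sums[OF x(2)], of "a * x ^ (2 * p)"] show ?thesis
      by (simp add: n power_add mult_ac)
  qed
  have "sin_tan_coeff (n + 1) * x ^ (2 * n - 1) * tan x < R"
  proof (rule sums_strict_less[OF tan R])
    have "sin_tan_coeff (n + 1) * tan_coeff (Suc j) \<le> sin_tan_coeff (n + Suc j)" for j
      using sin_tan_coeff_Suc_mult_less[of n "Suc j"] assms(3) tan_coeff_1 by (cases j) auto
    then show "sin_tan_coeff (n + 1) * tan_coeff (Suc j) * x ^ (2 * (j + n))
        \<le> sin_tan_coeff (n + Suc j) * x ^ (2 * (j + n))" for j
      using assms(1) by (intro mult_right_mono) auto
    \<comment> \<open>Strictness is taken from index 1: at index 0 the two terms are equal, since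
      T_1 = 1.\<close>
    show "sin_tan_coeff (n + 1) * tan_coeff (Suc 1) * x ^ (2 * (1 + n)) < sin_tan_coeff (n + Suc 1) * x ^ (2 * (1 + n))"
      using sin_tan_coeff_Suc_mult_less[of n "Suc 1"] assms by (intro mult_strict_right_mono) auto
  qed
  moreover have "R < (4 / pi\<^sup>2) ^ n * x ^ (2 * n - 1) * tan x"
  proof (rule sums_strict_less[OF R tan])
    have *: "sin_tan_coeff (n + Suc j) * x ^ (2 * (j + n)) < (4 / pi\<^sup>2) ^ n * tan_coeff (Suc j) * x ^ (2 * (j + n))" for j
      using assms by (intro mult_strict_right_mono sin_tan_coeff_add_less) auto
    show "sin_tan_coeff (n + Suc 0) * x ^ (2 * (0 + n)) < (4 / pi\<^sup>2) ^ n * tan_coeff (Suc 0) * x ^ (2 * (0 + n))"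
      by (rule *)
    show "sin_tan_coeff (n + Suc j) * x ^ (2 * (j + n)) \<le> (4 / pi\<^sup>2) ^ n * tan_coeff (Suc j) * x ^ (2 * (j + n))" for j
      using *[of j] by simp
  qed
  moreover have "(4 / pi\<^sup>2) ^ n = (2 / pi) ^ (2 * n)"
    by (simp add: power_mult power_divide)
  ultimately show ?thesis
    by (simp add: R_def sin_tan_coeff_def tan_coeff_def)
qed

end
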